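(* Let $q\ge2$ be an integer, $\theta_0=0$, $(\theta_1,\cdots,\theta_{q-1})\in\{0,1\}^{q-1}\setminus\{0^{q-1}\}$ and let $(\theta_n)_{n\ge0}$ be the $(0,\theta_1,\cdots,\theta_{q-1})$-Thue-Morse sequence. For $d\in\mathbb{N}$ and $a_1,\cdots,a_d,b_1,\cdots,b_d\in\mathbb{C}\setminus\{-1,-2,-3,\cdots\}$ with $a_1+\cdots+a_d=b_1+\cdots+b_d$, put $$\mathfrak{f}(a_1,\cdots,a_d;b_1,\cdots,b_d):=\prod_{n=1}^\infty\Big(\frac{(n+a_1)\cdots(n+a_d)}{(n+b_1)\cdots(n+b_d)}\Big)^{\theta_n}.$$ Then for all such $d$ and $a_1,\dots,a_d,b_1,\dots,b_d$, $$\mathfrak{f}(a_1,\cdots,a_d;b_1,\cdots,b_d)=\prod_{k=1}^{q-1}\Big(\prod_{i=1}^d\frac{\Gamma(\frac{b_i+k}{q})}{\Gamma(\frac{a_i+k}{q})}\Big)^{\theta_k}\cdot\prod_{k=0}^{q-1}\Big(\mathfrak{f}\big(\tfrac{a_1+k}{q},\cdots,\tfrac{a_d+k}{q};\tfrac{b_1+k}{q},\cdots,\tfrac{b_d+k}{q}\big)\Big)^{(-1)^{\theta_k}},$$ which is equivalent to $$\prod_{n=1}^\infty\Big(\prod_{i=1}^d\Big(\frac{n+a_i}{n+b_i}\cdot\prod_{k=0}^{q-1}\big(\frac{qn+b_i+k}{qn+a_i+k}\big)^{(-1)^{\theta_k}}\Big)\Big)^{\theta_n}=\prod_{k=1}^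{q-1}\Big(\prod_{i=1}^d\frac{\Gamma(\frac{b_i+k}{q})}{\Gamma(\frac{a_i+k}{q})}\Big)^{\theta_k}.$$
   Context: For an integer $q\ge2$ and $\theta_1,\dots,\theta_{q-1}\in\{0,1\}$, the $(0,\theta_1,\cdots,\theta_{q-1})$-Thue-Morse sequence $(\theta_n)_{n\ge0}$ is the unique fixed point of the morphism on $\{0,1\}$ given by $0\mapsto0\theta_1\cdots\theta_{q-1}$, $1\mapsto1\overline{\theta}_1\cdots\overline{\theta}_{q-1}$, beginning with $\theta_0:=0$, where $\overline{0}:=1$ and $\overline{1}:=0$. $\Gamma$ is Euler's Gamma function. *)

theory Defs
  imports "HOL-Analysis.Analysis" "HOL-Library.Stream"
begin

text \<open>
  Infinite words over the alphabet \<open>{0, 1}\<close> are streams of naturals. The list \<open>u\<close> holds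
  \<open>\<theta>\<^sub>1, \<dots>, \<theta>\<^sub>q\<^sub>-\<^sub>1\<close>, so that the image of each letter has length \<open>q = length u + 1\<close>, and
  \<open>1 - y\<close> is the bar operation on letters. A morphism acts on an infinite word \<open>s\<close> by
  concatenating the images of its letters, which is \<open>flat (smap \<sigma> s)\<close>.
\<close>

definition tm_morphism :: "nat list \<Rightarrow> nat \<Rightarrow> nat list" where
  "tm_morphism u x = (if x = 0 then 0 # u else 1 # map (\<lambda>y. 1 - y) u)"

definition is_thue_morse :: "nat list \<Rightarrow> nat stream \<Rightarrow> bool" where
  "is_thue_morse u s \<longleftrightarrow>
     s \<in> streams {0, 1} \<and> s !! 0 = 0 \<and> flat (smap (tm_morphism u) s) = s"

definition thue_morse :: "nat list \<Rightarrow> nat stream" where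
  "thue_morse u = (THE s. is_thue_morse u s)"

text \<open>
  The infinite product starts at \<open>n = 1\<close>, while \<^const>\<open>prodinf\<close> starts at \<open>0\<close>; hence the
  index shift by \<^const>\<open>Suc\<close>. The tuples \<open>(a\<^sub>1, \<dots>, a\<^sub>d)\<close> and \<open>(b\<^sub>1, \<dots>, b\<^sub>d)\<close> are functions
  of which only the values on \<open>{1..d}\<close> matter.
\<close>

definition tm_factor ::
    "(nat \<Rightarrow> nat) \<Rightarrow> nat \<Rightarrow> (nat \<Rightarrow> complex) \<Rightarrow> (nat \<Rightarrow> complex) \<Rightarrow> nat \<Rightarrow> complex" where
  "tm_factor \<theta> d a b n =
     ((\<Prod>i=1..d. of_nat n + a i) / (\<Prod>i=1..d. of_nat n + b i)) ^ \<theta> n"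

definition tm_prod ::
    "(nat \<Rightarrow> nat) \<Rightarrow> nat \<Rightarrow> (nat \<Rightarrow> complex) \<Rightarrow> (nat \<Rightarrow> complex) \<Rightarrow> complex" where
  "tm_prod \<theta> d a b = (\<Prod>n. tm_factor \<theta> d a b (Suc n))"

lemma stream_snth_ext: "(\<And>n. s !! n = t !! n) \<Longrightarrow> s = t"
  by (metis ext stream_smap_nats)

lemma length_tm_morphism [simp]: "length (tm_morphism u x) = Suc (length u)"
  by (simp add: tm_morphism_def)

lemma flat_smap_uniform_snth:
  assumes len: "\<And>x. length (f x) = q" and "q > 0"
  shows "flat (smap f s) !! n = f (s !! (n div q)) ! (n mod q)"
proof (induction n arbitrary: s rule: less_induct)
  case (less n)
  have ne: "\<forall>xs\<in>sset (smap f s). xs \<noteq> []"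
    using len \<open>q > 0\<close> by (auto simp: stream.set_map simp flip: length_greater_0_conv)
  show ?case
  proof (cases "n < q")
    case True
    then show ?thesis using flat_snth[OF ne, of n] len by simp
  next
    case False
    then have "flat (smap f s) !! n = flat (smap f (stl s)) !! (n - q)"
      using flat_snth[OF ne, of n] len by simp
    also have "\<dots> = f (stl s !! ((n - q) div q)) ! ((n - q) mod q)"
      using less.IH[of "n - q"] False \<open>q > 0\<close> by simp
    also have "\<dots> = f (s !! (n div q)) ! (n mod q)"
      using False \<open>q > 0\<close> by (simp add: le_div_geq le_mod_geq)
    finally show ?thesis .
  qed
qed

lemma thue_morse_ex1:
  assumes "u \<noteq> []" and "set u \<subseteq> {0, 1}"
  shows "\<exists>!s. is_thue_morse u s"
proof -
  define q where "q = Suc (length u)"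
  have q: "q \<ge> 2" using assms(1) by (cases u) (auto simp: q_def)
  have flat: "flat (smap (tm_morphism u) s) !! n = tm_morphism u (s !! (n div q)) ! (n mod q)" for s n
    by (rule flat_smap_uniform_snth) (simp_all add: q_def)
  have letters: "tm_morphism u x ! k \<in> {0, 1}" if "k < q" for x k
  proof -
    have "tm_morphism u x ! k \<in> set (tm_morphism u x)"
      using that by (intro nth_mem) (simp add: q_def)
    also have "\<dots> \<subseteq> {0, 1}" using assms(2) by (auto simp: tm_morphism_def)
    finally show ?thesis .
  qed
  define R where "R = less_than"
  define F where "F = (\<lambda>(f :: nat \<Rightarrow> nat) n. if n = 0 then 0 else tm_morphism u (f (n div q)) ! (n mod q))"
  define g where "g = wfrec R F"
  have g: "g n = (if n = 0 then 0 else tm_morphism u (g (n div q)) ! (n mod q))" for n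
  proof -
    have "g n = F (cut g R n) n"
      unfolding g_def by (subst wfrec) (simp_all add: R_def)
    then show ?thesis using q by (simp add: F_def R_def cut_apply)
  qed
  show ?thesis
  proof (rule ex_ex1I)
    define s where "s = smap g nats"
    have s: "s !! n = g n" for n by (simp add: s_def)
    have "flat (smap (tm_morphism u) s) !! n = s !! n" for n
    proof (cases "n = 0")
      case True
      moreover have "shd s = 0" using s[of 0] g[of 0] by simp
      ultimately show ?thesis by (simp add: flat tm_morphism_def)
    next
      case False
      then show ?thesis by (subst flat, subst (1 2) s, subst (2) g) simp
    qed
    then have "flat (smap (tm_morphism u) s) = s" by (rule stream_snth_ext)
    moreover have "s \<in> streams {0, 1}"
      unfolding streams_iff_snth
    proof
      fix n show "s !! n \<in> {0, 1}"
        using letters[of "n mod q" "g (n div q)"] q by (subst s, subst g) auto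
    qed
    moreover have "s !! 0 = 0" by (subst s, subst g) simp
    ultimately show "\<exists>s. is_thue_morse u s" unfolding is_thue_morse_def by blast
  next
    fix s t assume st: "is_thue_morse u s" "is_thue_morse u t"
    have "s !! n = t !! n" for n
    proof (induction n rule: less_induct)
      case (less n)
      show ?case
      proof (cases "n = 0")
        case True
        then show ?thesis using st by (simp add: is_thue_morse_def)
      next
        case False
        then have "s !! (n div q) = t !! (n div q)" using less.IH[of "n div q"] q by simp
        then show ?thesis using st flat[of s n] flat[of t n] by (simp add: is_thue_morse_def)
      qed
    qed
    then show "s = t" by (rule stream_snth_ext)
  qed
qed

lemma is_thue_morse_thue_morse:
  assumes "u \<noteq> []" and "set u \<subseteq> {0, 1}"
  shows "is_thue_morse u (thue_morse u)"
  unfolding thue_morse_def by (rule theI') (rule thue_morse_ex1[OF assms])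

end

theory Submission
  imports Defs
begin

text \<open>
  Split the product over \<open>n\<close> according to the last digit \<open>k\<close> of \<open>n = q m + k\<close> in base \<open>q\<close>. The
  \<open>n\<close>-th factor is then the \<open>m\<close>-th factor \<open>r\<close> for the parameters \<open>(a\<^sub>i + k) / q\<close> and
  \<open>(b\<^sub>i + k) / q\<close>, and since \<open>\<theta>\<^sub>n\<close> is the sum of \<open>\<theta>\<^sub>m\<close> and \<open>\<theta>\<^sub>k\<close> modulo 2,
  its power with exponent \<open>\<theta>\<^sub>n\<close> is \<open>r\<close> to the power \<open>\<theta>\<^sub>k + (-1)\<^bsup>\<theta>\<^sub>k\<^esup> \<theta>\<^sub>m\<close>.
  The second summand of the exponent yields the products on the right-hand side; the first one
  yields full products of \<open>r\<close> over all \<open>m \<ge> 0\<close>, which Gauss's limit formula for the Gamma function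
  evaluates. All products converge because \<open>\<Sum> a\<^sub>i = \<Sum> b\<^sub>i\<close> makes the factors \<open>1 + O(1 / n\<^sup>2)\<close>.
\<close>

section \<open>Quotients of linear factors\<close>

definition lin_quot :: "nat \<Rightarrow> (nat \<Rightarrow> complex) \<Rightarrow> (nat \<Rightarrow> complex) \<Rightarrow> nat \<Rightarrow> complex" where
  "lin_quot d a b n = (\<Prod>i=1..d. (of_nat n + a i) / (of_nat n + b i))"

lemma tm_factor_eq_lin_quot_power: "tm_factor \<theta> d a b n = lin_quot d a b n ^ \<theta> n"
  by (simp add: tm_factor_def lin_quot_def prod_dividef)

lemma lin_quot_nonzero:
  assumes "\<And>i. i \<in> {1..d} \<Longrightarrow> a i \<noteq> - of_nat n" "\<And>i. i \<in> {1..d} \<Longrightarrow> b i \<noteq> - of_nat n"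
  shows "lin_quot d a b n \<noteq> 0"
proof -
  have "of_nat n + a i \<noteq> 0" "of_nat n + b i \<noteq> 0" if "i \<in> {1..d}" for i
    using assms[OF that] by (auto simp: add_eq_0_iff)
  thus ?thesis by (simp add: lin_quot_def)
qed

text \<open>Numerator and denominator have \<open>d\<close> linear factors each, so the factor
  \<open>q\<close> pulled out of every one of them cancels.\<close>

lemma lin_quot_digit:
  assumes "q > 0"
  shows "lin_quot d a b (m * q + k) =
    lin_quot d (\<lambda>i. (a i + of_nat k) / of_nat q) (\<lambda>i. (b i + of_nat k) / of_nat q) m"
proof -
  have "of_nat (m * q + k) + x = of_nat q * (of_nat m + (x + of_nat k) / of_nat q)" for x :: complex
    using assms by (simp add: field_simps)
  thus ?thesis using assms unfolding lin_quot_def by simp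
qed

text \<open>Induction on \<open>A\<close>: if \<open>E\<close> is the error for \<open>A\<close>, a
  new factor \<open>1 + a x * v\<close> makes the error \<open>(1 + a x * v) * E\<close> plus the
  cross term \<open>a x * (\<Sum>i\<in>A. a i) * v ^ 2\<close>, both of order
  \<open>v ^ 2\<close>.\<close>

lemma prod_one_plus_expansion_bigo:
  fixes a :: "'i \<Rightarrow> complex"
  assumes "finite A"
  shows "(\<lambda>n. (\<Prod>i\<in>A. 1 + a i * inverse (of_nat n)) - 1 - (\<Sum>i\<in>A. a i) * inverse (of_nat n))
    \<in> O(\<lambda>n. inverse (of_nat n) ^ 2)"
  using assms
proof (induction A rule: finite_induct)
  case (insert x A)
  define v :: "nat \<Rightarrow> complex" where "v = (\<lambda>n. inverse (of_nat n))"
  define E where "E = (\<lambda>n. (\<Prod>i\<in>A. 1 + a i * v n) - 1 - (\<Sum>i\<in>A. a i) * v n)"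
  have E: "E \<in> O(\<lambda>n. v n ^ 2)" using insert.IH by (simp add: E_def v_def)
  have v: "v \<longlonglongrightarrow> 0" unfolding v_def by (rule lim_inverse_n)
  have "(\<lambda>n. 1 + a x * v n) \<longlonglongrightarrow> 1 + a x * 0" by (intro tendsto_intros v)
  hence "(\<lambda>n. 1 + a x * v n) \<in> O(\<lambda>_. 1)" by (intro bigoI_tendsto[where c = 1]) simp_all
  from landau_o.big.mult[OF this E]
  have "(\<lambda>n. (1 + a x * v n) * E n + a x * (\<Sum>i\<in>A. a i) * v n ^ 2) \<in> O(\<lambda>n. v n ^ 2)"
    by (intro sum_in_bigo) simp_all
  also have "(\<lambda>n. (1 + a x * v n) * E n + a x * (\<Sum>i\<in>A. a i) * v n ^ 2) =
     (\<lambda>n. (\<Prod>i\<in>insert x A. 1 + a i * v n) - 1 - (\<Sum>i\<in>insert x A. a i) * v n)"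
    using insert.hyps by (simp add: E_def algebra_simps power2_eq_square)
  finally show ?case by (simp add: v_def)
qed simp

text \<open>The equality of the two sums cancels the terms of order \<open>1 / n\<close>.\<close>

lemma lin_quot_minus_one_bigo:
  assumes "(\<Sum>i=1..d. a i) = (\<Sum>i=1..d. b i)"
  shows "(\<lambda>n. lin_quot d a b n - 1) \<in> O(\<lambda>n. inverse (of_nat n) ^ 2)"
proof -
  define v :: "nat \<Rightarrow> complex" where "v = (\<lambda>n. inverse (of_nat n))"
  define P where "P = (\<lambda>(c :: nat \<Rightarrow> complex) n. \<Prod>i=1..d. 1 + c i * v n)"
  have v: "v \<longlonglongrightarrow> 0" unfolding v_def by (rule lim_inverse_n)
  have diff: "(\<lambda>n. P a n - P b n) \<in> O(\<lambda>n. v n ^ 2)"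
    using sum_in_bigo(2)[OF prod_one_plus_expansion_bigo[of "{1..d}" a]
        prod_one_plus_expansion_bigo[of "{1..d}" b]] assms
    by (simp add: P_def v_def)
  have "P b \<longlonglongrightarrow> (\<Prod>i=1..d. 1 + b i * 0)"
    unfolding P_def by (intro tendsto_intros v)
  hence lim: "P b \<longlonglongrightarrow> 1" by simp
  hence "(\<lambda>n. inverse (P b n)) \<longlonglongrightarrow> inverse 1" by (intro tendsto_intros) simp_all
  hence "(\<lambda>n. inverse (P b n)) \<in> O(\<lambda>_. 1)" by (intro bigoI_tendsto[where c = 1]) simp_all
  from landau_o.big.mult[OF diff this]
  have "(\<lambda>n. (P a n - P b n) * inverse (P b n)) \<in> O(\<lambda>n. v n ^ 2)" by simp
  also have "?this \<longleftrightarrow> ?thesis"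
    unfolding v_def
  proof (rule landau_o.big.in_cong)
    have "eventually (\<lambda>n. P b n \<noteq> 0) sequentially"
      using tendsto_imp_eventually_ne[OF lim] by simp
    thus "eventually (\<lambda>n. (P a n - P b n) * inverse (P b n) = lin_quot d a b n - 1) sequentially"
      using eventually_gt_at_top[of 0]
    proof eventually_elim
      case (elim n)
      \<comment> \<open>For \<open>n > 0\<close>, the \<open>d\<close> factors \<open>n\<close>
        cancel between numerator and denominator of \<open>lin_quot\<close>.\<close>
      have *: "of_nat n + x = of_nat n * (1 + x * v n)" for x :: complex
        using elim by (simp add: v_def field_simps)
      have "lin_quot d a b n = P a n / P b n"
        using elim unfolding lin_quot_def P_def * by (simp add: prod_dividef)
      thus ?case using elim by (simp add: field_simps)
    qed
  qed
  finally show ?thesis .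
qed

text \<open>In the quotients of Gauss's approximants the factorials cancel, and the powers
  \<open>N ^ (b i - a i)\<close> multiply to 1 because the sums agree; only the Pochhammer symbols
  remain. The condition on \<open>a\<close> keeps the limits \<open>Gamma (a i)\<close> in the
  denominators nonzero.\<close>

lemma prod_lin_quot_tendsto_Gamma:
  assumes "(\<Sum>i=1..d. a i) = (\<Sum>i=1..d. b i)"
    and "\<And>i. i \<in> {1..d} \<Longrightarrow> a i \<notin> \<int>\<^sub>\<le>\<^sub>0"
  shows "(\<lambda>N. \<Prod>m<N. lin_quot d a b m) \<longlonglongrightarrow> (\<Prod>i=1..d. Gamma (b i) / Gamma (a i))"
proof -
  have "(\<lambda>N. \<Prod>i=1..d. Gamma_series' (b i) N / Gamma_series' (a i) N)
      \<longlonglongrightarrow> (\<Prod>i=1..d. Gamma (b i) / Gamma (a i))"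
    using assms(2) by (intro tendsto_intros Gamma_series'_LIMSEQ) (auto simp: Gamma_eq_zero_iff)
  also have "(\<lambda>N. \<Prod>i=1..d. Gamma_series' (b i) N / Gamma_series' (a i) N) =
      (\<lambda>N. \<Prod>m<N. lin_quot d a b m)"
  proof
    fix N :: nat
    define L :: complex where "L = of_real (ln (of_nat N))"
    have "(\<Prod>i=1..d. Gamma_series' (b i) N / Gamma_series' (a i) N) =
        (\<Prod>i=1..d. exp (b i * L) / exp (a i * L) * (pochhammer (a i) N / pochhammer (b i) N))"
      by (rule prod.cong) (simp_all add: Gamma_series'_def L_def)
    also have "\<dots> = exp ((\<Sum>i=1..d. b i) * L) / exp ((\<Sum>i=1..d. a i) * L) *
        (\<Prod>i=1..d. pochhammer (a i) N / pochhammer (b i) N)"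
      by (simp add: prod.distrib prod_dividef exp_sum sum_distrib_right)
    also have "\<dots> = (\<Prod>i=1..d. \<Prod>m<N. (of_nat m + a i) / (of_nat m + b i))"
      using assms(1) by (simp add: pochhammer_prod prod_dividef atLeast0LessThan add.commute)
    also have "\<dots> = (\<Prod>m<N. lin_quot d a b m)"
      unfolding lin_quot_def by (rule prod.swap)
    finally show "(\<Prod>i=1..d. Gamma_series' (b i) N / Gamma_series' (a i) N) =
      (\<Prod>m<N. lin_quot d a b m)" .
  qed
  finally show ?thesis .
qed

section \<open>Convergence\<close>

lemma digit_eq_minus_of_natD:
  fixes x :: "'a :: field_char_0"
  assumes "q > 0" "(x + of_nat k) / of_nat q = - of_nat m"
  shows "x = - of_nat (q * m + k)"
  using assms by (simp add: field_simps eq_neg_iff_add_eq_0)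

text \<open>Collects what convergence rests on, so that the results can also be applied to the
  shifted parameters \<open>(a i + k) / q\<close> with the same \<open>\<theta>\<close>.\<close>

locale tm_parameters =
  fixes \<theta> :: "nat \<Rightarrow> nat" and d :: nat and a b :: "nat \<Rightarrow> complex"
  assumes binary: "\<theta> n \<in> {0, 1}" and zero: "\<theta> 0 = 0"
    and a_nonpole: "i \<in> {1..d} \<Longrightarrow> m \<ge> 1 \<Longrightarrow> a i \<noteq> - of_nat m"
    and b_nonpole: "i \<in> {1..d} \<Longrightarrow> m \<ge> 1 \<Longrightarrow> b i \<noteq> - of_nat m"
    and sum_eq: "(\<Sum>i=1..d. a i) = (\<Sum>i=1..d. b i)"
begin

lemma tm_factor_nonzero: "tm_factor \<theta> d a b n \<noteq> 0"
proof (cases "n = 0")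
  case False
  thus ?thesis
    using lin_quot_nonzero[of d a n b] a_nonpole[of _ n] b_nonpole[of _ n]
    by (simp add: tm_factor_eq_lin_quot_power)
qed (simp add: tm_factor_def zero)

lemma convergent_prod_tm_factor: "convergent_prod (\<lambda>n. tm_factor \<theta> d a b (Suc n))"
proof -
  have "(\<lambda>n. norm (lin_quot d a b n - 1)) \<in> O(\<lambda>n. norm (inverse (of_nat n) ^ 2 :: complex))"
    using lin_quot_minus_one_bigo[OF sum_eq] by simp
  hence "(\<lambda>n. norm (lin_quot d a b n - 1)) \<in> O(\<lambda>n. inverse (of_nat n ^ 2))"
    by (simp add: norm_power norm_inverse power_inverse)
  moreover have "summable (\<lambda>n. norm (inverse (of_nat n ^ 2) :: real))"
    using inverse_power_summable[of 2, where 'a = real] by (simp add: norm_inverse norm_power)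
  ultimately have "summable (\<lambda>n. norm (lin_quot d a b n - 1))"
    by (rule summable_comparison_test_bigo[rotated])
  \<comment> \<open>An exponent 0 or 1 turns \<open>lin_quot d a b n - 1\<close> into 0 or leaves it
    unchanged.\<close>
  hence "summable (\<lambda>n. norm (tm_factor \<theta> d a b n - 1))"
  proof (rule summable_comparison_test'[where N = 0])
    fix n
    show "norm (norm (tm_factor \<theta> d a b n - 1)) \<le> norm (lin_quot d a b n - 1)"
      using binary[of n] by (auto simp: tm_factor_eq_lin_quot_power)
  qed
  hence "summable (\<lambda>n. norm (tm_factor \<theta> d a b (Suc n) - 1))"
    by (simp add: summable_Suc_iff[of "\<lambda>n. norm (tm_factor \<theta> d a b n - 1)"])
  hence "abs_convergent_prod (\<lambda>n. tm_factor \<theta> d a b (Suc n))"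
    by (rule summable_imp_abs_convergent_prod)
  thus ?thesis by (rule abs_convergent_prod_imp_convergent_prod)
qed

text \<open>Allows passing to the limit under the exponent -1.\<close>

lemma tm_prod_nonzero: "tm_prod \<theta> d a b \<noteq> 0"
  unfolding tm_prod_def by (intro prodinf_nonzero convergent_prod_tm_factor tm_factor_nonzero)

text \<open>Since \<open>\<theta> 0 = 0\<close>, the factor at \<open>n = 0\<close> is \<open>1\<close>, whatever \<open>a\<close> and \<open>b\<close> are.\<close>

lemma prod_tm_factor_tendsto: "(\<lambda>N. \<Prod>n<N. tm_factor \<theta> d a b n) \<longlonglongrightarrow> tm_prod \<theta> d a b"
proof -
  have "(\<lambda>N. \<Prod>n\<le>N. tm_factor \<theta> d a b (Suc n)) \<longlonglongrightarrow> tm_prod \<theta> d a b"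
    unfolding tm_prod_def by (rule convergent_prod_LIMSEQ[OF convergent_prod_tm_factor])
  moreover have "(\<Prod>n\<le>N. tm_factor \<theta> d a b (Suc n)) = (\<Prod>n<N+2. tm_factor \<theta> d a b n)" for N
    by (simp add: prod.lessThan_Suc_shift lessThan_Suc_atMost[symmetric] tm_factor_def zero
             del: prod.lessThan_Suc)
  ultimately have "(\<lambda>N. \<Prod>n<N+2. tm_factor \<theta> d a b n) \<longlonglongrightarrow> tm_prod \<theta> d a b" by simp
  thus ?thesis by (rule LIMSEQ_offset)
qed

lemma tm_parameters_digit:
  assumes "q > 0"
  shows "tm_parameters \<theta> d (\<lambda>i. (a i + of_nat k) / of_nat q) (\<lambda>i. (b i + of_nat k) / of_nat q)"
proof
  show "(a i + of_nat k) / of_nat q \<noteq> - of_nat m" if "i \<in> {1..d}" "m \<ge> 1" for i m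
    using digit_eq_minus_of_natD[of q "a i" k m] a_nonpole[OF that(1), of "q * m + k"] that assms
    by (auto simp: Suc_le_eq)
  show "(b i + of_nat k) / of_nat q \<noteq> - of_nat m" if "i \<in> {1..d}" "m \<ge> 1" for i m
    using digit_eq_minus_of_natD[of q "b i" k m] b_nonpole[OF that(1), of "q * m + k"] that assms
    by (auto simp: Suc_le_eq)
  show "(\<Sum>i=1..d. (a i + of_nat k) / of_nat q) = (\<Sum>i=1..d. (b i + of_nat k) / of_nat q)"
    using sum_eq by (simp add: sum.distrib flip: sum_divide_distrib)
qed (use binary zero in auto)

text \<open>A value \<open>-m\<close> with \<open>m \<ge> 0\<close> would make the original
  parameter \<open>-(q * m + k)\<close>. Since \<open>k \<ge> 1\<close>, this is a negative integer
  even for \<open>m = 0\<close>.\<close>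

lemma digit_notin_nonpos_Ints:
  assumes "k \<ge> 1" "q > 0" "i \<in> {1..d}"
  shows "(a i + of_nat k) / of_nat q \<notin> \<int>\<^sub>\<le>\<^sub>0" "(b i + of_nat k) / of_nat q \<notin> \<int>\<^sub>\<le>\<^sub>0"
proof -
  have *: "\<exists>m\<ge>1. x = - of_nat m" if x: "(x + of_nat k) / of_nat q \<in> \<int>\<^sub>\<le>\<^sub>0" for x :: complex
  proof -
    obtain m where "(x + of_nat k) / of_nat q = - of_nat m"
      using x by (elim nonpos_Ints_cases')
    from digit_eq_minus_of_natD[OF assms(2) this] show ?thesis
      using assms(1) by (intro exI[of _ "q * m + k"]) auto
  qed
  show "(a i + of_nat k) / of_nat q \<notin> \<int>\<^sub>\<le>\<^sub>0" using *[of "a i"] a_nonpole[OF assms(3)] by auto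
  show "(b i + of_nat k) / of_nat q \<notin> \<int>\<^sub>\<le>\<^sub>0" using *[of "b i"] b_nonpole[OF assms(3)] by auto
qed

end

section \<open>The functional equation\<close>

text \<open>Letter \<open>n\<close> of the fixed point is entry \<open>n mod q\<close> of the image
  of letter \<open>n div q\<close>. As \<open>\<theta> 0 = 0\<close>, the image of 0 is the initial
  block of \<open>\<theta>\<close> itself, and the image of 1 is its complement.\<close>

lemma thue_morse_digit:
  assumes "q \<ge> 2" "length u = q - 1" "set u \<subseteq> {0, 1}"
  defines "\<theta> \<equiv> snth (thue_morse u)"
  shows "\<theta> n \<in> {0, 1}" "\<theta> 0 = 0"
    "k < q \<Longrightarrow> \<theta> (m * q + k) = (if \<theta> m = 0 then \<theta> k else 1 - \<theta> k)"
proof -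
  have "u \<noteq> []" using assms by auto
  hence tm: "is_thue_morse u (thue_morse u)"
    using assms by (intro is_thue_morse_thue_morse)
  show bin: "\<theta> n \<in> {0, 1}" for n
    using tm by (auto simp: is_thue_morse_def streams_iff_snth \<theta>_def)
  show z: "\<theta> 0 = 0" using tm by (simp add: is_thue_morse_def \<theta>_def)
  have rec: "\<theta> n = tm_morphism u (\<theta> (n div q)) ! (n mod q)" for n
    using tm flat_smap_uniform_snth[of "tm_morphism u" q "thue_morse u" n] assms
    by (simp add: is_thue_morse_def)
  assume k: "k < q"
  have "\<theta> (m * q + k) = tm_morphism u (\<theta> m) ! k" using rec[of "m * q + k"] k by simp
  moreover have "\<theta> k = tm_morphism u 0 ! k" using rec[of k] k z by simp
  ultimately show "\<theta> (m * q + k) = (if \<theta> m = 0 then \<theta> k else 1 - \<theta> k)"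
    using k assms(2) by (cases k) (auto simp: tm_morphism_def)
qed

lemma prod_power_int_distrib:
  fixes f :: "'i \<Rightarrow> 'a :: field"
  shows "(\<Prod>i\<in>A. f i) powi n = (\<Prod>i\<in>A. f i powi n)"
  by (induction A rule: infinite_finite_induct) (simp_all add: power_int_mult_distrib)

lemma has_prodI_nonzero:
  fixes f :: "nat \<Rightarrow> 'a :: {t2_space, comm_semiring_1}"
  assumes "(\<lambda>N. \<Prod>n<N. f n) \<longlonglongrightarrow> p" "p \<noteq> 0"
  shows "f has_prod p"
proof -
  have "(\<lambda>N. \<Prod>n\<le>N. f n) \<longlonglongrightarrow> p"
    using LIMSEQ_Suc[OF assms(1)] by (simp add: lessThan_Suc_atMost)
  thus ?thesis using assms(2) by (simp add: has_prod_def raw_has_prod_def)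
qed

theorem theorem1p9:
  fixes q d :: nat and u :: "nat list" and \<theta> :: "nat \<Rightarrow> nat" and a b :: "nat \<Rightarrow> complex"
  assumes "q \<ge> 2"
    and "length u = q - 1" and "set u \<subseteq> {0, 1}" and "u \<noteq> replicate (q - 1) 0"
    and "\<theta> = snth (thue_morse u)"
    and "\<And>i m. i \<in> {1..d} \<Longrightarrow> m \<ge> 1 \<Longrightarrow> a i \<noteq> - of_nat m"
    and "\<And>i m. i \<in> {1..d} \<Longrightarrow> m \<ge> 1 \<Longrightarrow> b i \<noteq> - of_nat m"
    and "(\<Sum>i=1..d. a i) = (\<Sum>i=1..d. b i)"
  shows "convergent_prod (\<lambda>n. tm_factor \<theta> d a b (Suc n)) \<and>
    tm_prod \<theta> d a b =
      (\<Prod>k=1..q-1. (\<Prod>i=1..d. Gamma ((b i + of_nat k) / of_nat q) / Gamma ((a i + of_nat k) / of_nat q)) ^ \<theta> k) *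
      (\<Prod>k=0..q-1. tm_prod \<theta> d (\<lambda>i. (a i + of_nat k) / of_nat q) (\<lambda>i. (b i + of_nat k) / of_nat q)
                     powi ((-1) ^ \<theta> k)) \<and>
    (\<lambda>n. (\<Prod>i=1..d. (of_nat (Suc n) + a i) / (of_nat (Suc n) + b i) *
                 (\<Prod>k=0..q-1. ((of_nat q * of_nat (Suc n) + b i + of_nat k) /
                                (of_nat q * of_nat (Suc n) + a i + of_nat k)) powi ((-1) ^ \<theta> k)))
               ^ \<theta> (Suc n))
      has_prod
      (\<Prod>k=1..q-1. (\<Prod>i=1..d. Gamma ((b i + of_nat k) / of_nat q) / Gamma ((a i + of_nat k) / of_nat q)) ^ \<theta> k)"
proof -
  have q: "q > 0" using assms(1) by simp
  have digit: "\<theta> (m * q + k) = (if \<theta> m = 0 then \<theta> k else 1 - \<theta> k)" if "k < q" for m k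
    using thue_morse_digit(3)[OF assms(1-3)] that unfolding assms(5) by blast
  interpret tm_parameters \<theta> d a b
  proof
    show "\<theta> n \<in> {0, 1}" for n
      using thue_morse_digit(1)[OF assms(1-3)] unfolding assms(5) by blast
    show "\<theta> 0 = 0"
      using thue_morse_digit(2)[OF assms(1-3)] unfolding assms(5) by blast
  qed (use assms in blast)+
  define \<alpha> where "\<alpha> = (\<lambda>k i. (a i + of_nat k) / of_nat q)"
  define \<beta> where "\<beta> = (\<lambda>k i. (b i + of_nat k) / of_nat q)"
  define s :: "nat \<Rightarrow> int" where "s = (\<lambda>k. (-1) ^ \<theta> k)"
  define r where "r = (\<lambda>k. lin_quot d (\<alpha> k) (\<beta> k))"
  define f where "f = (\<lambda>k. tm_factor \<theta> d (\<alpha> k) (\<beta> k))"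
  define F where "F = (\<lambda>k. tm_prod \<theta> d (\<alpha> k) (\<beta> k))"
  define H where "H = (\<lambda>k. \<Prod>i=1..d. Gamma (\<beta> k i) / Gamma (\<alpha> k i))"
  define G where "G = (\<Prod>k=1..q-1. H k ^ \<theta> k)"
  have params: "tm_parameters \<theta> d (\<alpha> k) (\<beta> k)" for k
    unfolding \<alpha>_def \<beta>_def by (rule tm_parameters_digit[OF q])
  have f_eq: "f k m = r k m ^ \<theta> m" for k m
    by (simp add: f_def r_def tm_factor_eq_lin_quot_power)
  have f_nonzero: "f k m \<noteq> 0" for k m
    unfolding f_def by (rule tm_parameters.tm_factor_nonzero[OF params])
  have F_nonzero: "F k \<noteq> 0" for k
    unfolding F_def by (rule tm_parameters.tm_prod_nonzero[OF params])
  have f_lim: "(\<lambda>N. \<Prod>m<N. f k m) \<longlonglongrightarrow> F k" for k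
    unfolding f_def F_def by (rule tm_parameters.prod_tm_factor_tendsto[OF params])
  have H_lim: "(\<lambda>N. \<Prod>m<N. r k m) \<longlonglongrightarrow> H k" if "k \<ge> 1" for k
    unfolding r_def H_def
  proof (rule prod_lin_quot_tendsto_Gamma)
    show "sum (\<alpha> k) {1..d} = sum (\<beta> k) {1..d}"
      by (rule tm_parameters.sum_eq[OF params])
    show "\<alpha> k i \<notin> \<int>\<^sub>\<le>\<^sub>0" if "i \<in> {1..d}" for i
      unfolding \<alpha>_def using digit_notin_nonpos_Ints(1)[OF \<open>k \<ge> 1\<close> q that] .
  qed
  have H_nonzero: "H k \<noteq> 0" if "k \<ge> 1" for k
    using digit_notin_nonpos_Ints[OF that q]
    by (auto simp: H_def \<alpha>_def \<beta>_def Gamma_eq_zero_iff)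
  have range_q: "{0..q-1} = {..<q}" using q by auto
  have G_eq: "G = (\<Prod>k<q. H k ^ \<theta> k)"
    unfolding G_def by (rule prod.mono_neutral_left) (auto simp: zero not_le)

  \<comment> \<open>Splitting the product by the last digit\<close>
  have factor: "tm_factor \<theta> d a b (m * q + k) = r k m ^ \<theta> k * f k m powi s k" if "k < q" for k m
  proof -
    have "tm_factor \<theta> d a b (m * q + k) = r k m ^ \<theta> (m * q + k)"
      by (simp add: tm_factor_eq_lin_quot_power lin_quot_digit[OF q] r_def \<alpha>_def \<beta>_def)
    thus ?thesis
      \<comment> \<open>When \<open>\<theta> k = \<theta> m = 1\<close>, the claim is
        \<open>1 = r * inverse r\<close>; there \<open>r\<close> equals \<open>f\<close> and hence
        is nonzero.\<close>
      using binary[of k] binary[of m] f_nonzero[of k m]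
      by (auto simp: digit[OF that] f_eq s_def)
  qed
  \<comment> \<open>Stopping at multiples of \<open>q\<close> leaves only complete blocks of digits;
    along this subsequence the partial products still tend to \<open>tm_prod\<close>.\<close>
  have "(\<Prod>n<N*q. tm_factor \<theta> d a b n) =
      (\<Prod>k<q. (\<Prod>m<N. r k m) ^ \<theta> k * (\<Prod>m<N. f k m) powi s k)" for N
  proof -
    have shift: "(\<Prod>n=c..<c+q. g n) = (\<Prod>k<q. g (c + k))" for c and g :: "nat \<Rightarrow> complex"
      using prod.shift_bounds_nat_ivl[of g 0 c q] by (simp add: atLeast0LessThan add.commute)
    have "(\<Prod>n<N*q. tm_factor \<theta> d a b n) = (\<Prod>m<N. \<Prod>n=m*q..<m*q+q. tm_factor \<theta> d a b n)"
      by (rule prod.nat_group[symmetric])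
    also have "\<dots> = (\<Prod>m<N. \<Prod>k<q. tm_factor \<theta> d a b (m * q + k))"
      by (simp add: shift)
    also have "\<dots> = (\<Prod>m<N. \<Prod>k<q. r k m ^ \<theta> k * f k m powi s k)"
      by (simp add: factor)
    also have "\<dots> = (\<Prod>k<q. \<Prod>m<N. r k m ^ \<theta> k * f k m powi s k)"
      by (rule prod.swap)
    finally show ?thesis
      by (simp add: prod.distrib prod_power_distrib prod_power_int_distrib)
  qed
  moreover have "(\<lambda>N. \<Prod>k<q. (\<Prod>m<N. r k m) ^ \<theta> k * (\<Prod>m<N. f k m) powi s k)
      \<longlonglongrightarrow> (\<Prod>k<q. H k ^ \<theta> k * F k powi s k)"
  proof (intro tendsto_prod tendsto_mult)
    fix k
    show "(\<lambda>N. (\<Prod>m<N. r k m) ^ \<theta> k) \<longlonglongrightarrow> H k ^ \<theta> k"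
      \<comment> \<open>\<open>H_lim\<close> covers \<open>k \<ge> 1\<close>; for
        \<open>k = 0\<close> both sides are 1, the exponent being
        \<open>\<theta> 0 = 0\<close>.\<close>
      by (cases "k = 0") (auto simp: zero intro!: tendsto_power H_lim)
    show "(\<lambda>N. (\<Prod>m<N. f k m) powi s k) \<longlonglongrightarrow> F k powi s k"
      by (intro tendsto_power_int f_lim F_nonzero)
  qed
  moreover have "(\<lambda>N. \<Prod>n<N*q. tm_factor \<theta> d a b n) \<longlonglongrightarrow> tm_prod \<theta> d a b"
    by (rule filterlim_compose[OF prod_tm_factor_tendsto mult_nat_right_at_top[OF q]])
  ultimately have "tm_prod \<theta> d a b = (\<Prod>k<q. H k ^ \<theta> k * F k powi s k)"
    by (simp add: LIMSEQ_unique)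
  hence main: "tm_prod \<theta> d a b = G * (\<Prod>k<q. F k powi s k)"
    by (simp add: G_eq prod.distrib)

  \<comment> \<open>The equivalent product formula\<close>
  define t where "t = (\<lambda>n. (\<Prod>i=1..d. (of_nat n + a i) / (of_nat n + b i) *
                 (\<Prod>k=0..q-1. ((of_nat q * of_nat n + b i + of_nat k) /
                                (of_nat q * of_nat n + a i + of_nat k)) powi ((-1) ^ \<theta> k)))
               ^ \<theta> n)"
  \<comment> \<open>The inner quotients are the inverted linear factors of \<open>r k n\<close>; the
    outer exponent \<open>\<theta> n\<close> turns \<open>r k n\<close> into
    \<open>f k n\<close>.\<close>
  have t: "t n = tm_factor \<theta> d a b n * inverse (\<Prod>k<q. f k n powi s k)" for n
  proof -
    have "of_nat q * of_nat n + x + of_nat k = of_nat q * (of_nat n + (x + of_nat k) / of_nat q)"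
      for x :: complex and k
      using q by (simp add: field_simps)
    hence quot: "(of_nat q * of_nat n + b i + of_nat k) / (of_nat q * of_nat n + a i + of_nat k) =
        inverse ((of_nat n + \<alpha> k i) / (of_nat n + \<beta> k i))" for i k
      using q by (simp add: \<alpha>_def \<beta>_def)
    have "t n = (lin_quot d a b n *
        (\<Prod>i=1..d. \<Prod>k<q. inverse ((of_nat n + \<alpha> k i) / (of_nat n + \<beta> k i)) powi s k)) ^ \<theta> n"
      unfolding t_def quot range_q prod.distrib by (simp add: lin_quot_def s_def)
    also have "(\<Prod>i=1..d. \<Prod>k<q. inverse ((of_nat n + \<alpha> k i) / (of_nat n + \<beta> k i)) powi s k) =
        (\<Prod>k<q. \<Prod>i=1..d. inverse ((of_nat n + \<alpha> k i) / (of_nat n + \<beta> k i)) powi s k)"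
      by (rule prod.swap)
    also have "\<dots> = (\<Prod>k<q. inverse (r k n powi s k))"
      by (simp add: r_def lin_quot_def prod_power_int_distrib power_int_inverse
          flip: prod_inversef del: inverse_divide)
    finally show ?thesis
      using binary[of n]
      by (auto simp: f_eq tm_factor_eq_lin_quot_power simp flip: prod_inversef)
  qed
  have "(\<lambda>N. (\<Prod>n<N. tm_factor \<theta> d a b n) * inverse (\<Prod>k<q. (\<Prod>n<N. f k n) powi s k))
      \<longlonglongrightarrow> tm_prod \<theta> d a b * inverse (\<Prod>k<q. F k powi s k)"
    using F_nonzero by (intro tendsto_intros prod_tm_factor_tendsto f_lim) auto
  also have "tm_prod \<theta> d a b * inverse (\<Prod>k<q. F k powi s k) = G"
    using F_nonzero by (simp add: main)
  also have "(\<lambda>N. (\<Prod>n<N. tm_factor \<theta> d a b n) * inverse (\<Prod>k<q. (\<Prod>n<N. f k n) powi s k)) =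
      (\<lambda>N. \<Prod>n<N. t n)"
    unfolding t prod.distrib prod_power_int_distrib
    by (subst prod.swap) (simp flip: prod_inversef)
  finally have "(\<lambda>N. \<Prod>n<Suc N. t n) \<longlonglongrightarrow> G" by (rule LIMSEQ_Suc)
  \<comment> \<open>The index 0, absent from the claimed product, contributes nothing.\<close>
  moreover have "t 0 = 1" by (simp add: t_def zero)
  ultimately have "(\<lambda>N. \<Prod>n<N. t (Suc n)) \<longlonglongrightarrow> G"
    by (simp add: prod.lessThan_Suc_shift del: prod.lessThan_Suc)
  moreover have "G \<noteq> 0" using H_nonzero by (simp add: G_def)
  ultimately have "(\<lambda>n. t (Suc n)) has_prod G" by (rule has_prodI_nonzero)
  with main convergent_prod_tm_factor show ?thesis
    unfolding G_def H_def F_def s_def t_def \<alpha>_def \<beta>_def range_q by blast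
qed

end
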